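(* Let $n$ be a positive even integer, let $q=2^n$, and let $a\in\mathbb{F}_{q^3}^*$. Then the polynomial $$f_2(x)=x^{\frac{q^2+q}{2}}+ax$$ is a permutation polynomial of $\mathbb{F}_{q^3}$ if and only if $a\in\mu_{q^2+q+1}$ and $a\notin\mu_{\frac{q^2+q+1}{3}}$.
   Context: $\mathbb{F}_Q$ denotes the finite field with $Q$ elements and $\mathbb{F}_Q^*$ its nonzero elements. A polynomial $f\in\mathbb{F}_Q[x]$ is a permutation polynomial of $\mathbb{F}_Q$ if the map $c\mapsto f(c)$ is a bijection of $\mathbb{F}_Q$. For a positive integer $d$, $\mu_d$ denotes the set of $d$-th roots of unity (elements $u$ with $u^d=1$). For even $n$, $3$ divides $q^2+q+1$. *)

theory Defs
  imports
    "HOL-Computational_Algebra.Computational_Algebra"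
    "HOL-Library.Cardinality"
begin

definition roots_of_unity :: "nat \<Rightarrow> 'a::field set" (\<open>\<mu>\<close>)
  where "\<mu> d = {u. u ^ d = 1}"

definition permutation_polynomial :: "'a::field poly \<Rightarrow> bool"
  where "permutation_polynomial f \<longleftrightarrow> bij (poly f)"

end

theory Submission
  imports Defs
begin

text \<open>
  Write \<open>D = (q\<^sup>2 + q + 1) / 3\<close> and \<open>b = a\<^sup>2\<close>. Squaring is a bijection in characteristic 2, so
  \<open>f\<^sub>2\<close> permutes the field iff \<open>g x = f\<^sub>2(x)\<^sup>2 = x ^ (q\<^sup>2 + q) + b x\<^sup>2\<close> is injective. The condition on
  \<open>a\<close> says that \<open>a ^ D\<close>, or equivalently \<open>c = b ^ D\<close>, is a primitive cube root of unity, that is,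
  \<open>c\<^sup>2 + c + 1 = 0\<close>. So the claim is that \<open>g\<close> is injective iff \<open>c\<^sup>2 + c + 1 = 0\<close>.

  Injectivity (\<open>quadratic_map_inj\<close>). Let \<open>x' = x ^ q\<close>. Since \<open>g\<close> is a quadratic form, a collision of
  \<open>g\<close> at \<open>x\<close> and \<open>x + \<delta>\<close> with \<open>\<delta> \<noteq> 0\<close> gives, after division by \<open>\<delta>' \<delta>''\<close>, the equation
  \<open>s' + s'' + 1 = T\<close> with \<open>s = x / \<delta>\<close> and \<open>T = b \<delta>\<^sup>2 / (\<delta>' \<delta>'')\<close>; hence \<open>T\<close> has trace 1 over the field with \<open>q\<close>
  elements. But \<open>T ^ D = c = c ^ D\<close>, so \<open>T / c\<close> is a \<open>D\<close>-th root of unity and has the form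
  \<open>r\<^sup>2 / (r' r'')\<close>. The trace condition becomes \<open>c (r\<^sup>3 + r'\<^sup>3 + r''\<^sup>3) = r r' r''\<close>. This cubic is a
  member of the Hesse pencil that splits into three lines. Frobenius permutes them cyclically, so a
  nonzero solution would give a point on all three, but they are not concurrent. Hence \<open>r = 0\<close>
  (\<open>cubic_form_anisotropic\<close>), a contradiction.

  Necessity (\<open>quadratic_map_inj_imp\<close>). This is Hermite's criterion for a single exponent. If \<open>g\<close> is a
  permutation then the sum of \<open>g(x) ^ k\<close> over all \<open>x\<close> vanishes for \<open>0 < k < q\<^sup>3 - 1\<close>. For
  \<open>k = (q - 1)(2q + 1)\<close> and \<open>x \<noteq> 0\<close>, \<open>g(x) ^ k\<close> is a polynomial in the \<open>D\<close>-th root of unity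
  \<open>X = x ^ ((q - 1)(q + 2))\<close>, and only the powers of \<open>X\<close> whose exponent is divisible by \<open>D\<close>
  contribute to the sum. The parity of the binomial coefficients leaves just three of them:
  the sum is \<open>b ^ q\<^sup>2 + b ^ (q\<^sup>2 - D) + b ^ (q\<^sup>2 - 2D) = b ^ (q\<^sup>2 - 2D) (c\<^sup>2 + c + 1)\<close>.
\<close>

section \<open>Powers in finite fields\<close>

text \<open>Translation by 1 permutes the field, so it does not change the sum of all elements.\<close>
lemma finite_field_of_nat_CARD: "of_nat CARD('a) = (0 :: 'a::finite_field)"
proof -
  have "(\<Sum>x\<in>UNIV. x :: 'a) = (\<Sum>x\<in>UNIV. x + 1)"
    by (rule sum.reindex_bij_witness[of _ "\<lambda>x. x + 1" "\<lambda>x. x - 1"]) auto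
  then show ?thesis by (simp add: sum.distrib)
qed

lemma CARD_finite_field_gt_1: "CARD('a::finite_field) > 1"
proof -
  have "card {0, 1 :: 'a} \<le> CARD('a)" by (rule card_mono) auto
  then show ?thesis by simp
qed

lemma card_nonzero: "card (-{0::'a::finite_field}) = CARD('a) - 1"
  by (simp add: Compl_eq_Diff_UNIV card_Diff_singleton)

lemma finite_field_power_eq_1:
  fixes x :: "'a::finite_field"
  assumes "x \<noteq> 0" and "CARD('a) - 1 dvd k"
  shows "x ^ k = 1"
proof -
  have "x * x ^ (CARD('a) - 1) = x ^ CARD('a)"
    using CARD_finite_field_gt_1[where 'a = 'a] by (simp flip: power_Suc)
  then have "x ^ (CARD('a) - 1) = 1"
    using assms(1) by (simp add: finite_field_power_card_eq_same)
  then show ?thesis using assms(2) by (metis dvdE power_mult power_one)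
qed

lemma card_nth_roots_le:
  fixes c :: "'a::finite_field"
  assumes "m > 0"
  shows "card {t. t ^ m = c} \<le> m"
proof -
  let ?p = "Polynomial.monom 1 m - [:c:]"
  have "coeff ?p m = 1" using assms by (simp add: coeff_pCons split: nat.splits)
  then have "?p \<noteq> 0" by (metis coeff_0 zero_neq_one)
  moreover have "degree ?p \<le> m" by (rule degree_diff_le) (auto simp: degree_monom_eq)
  moreover have "{t. t ^ m = c} = {t. poly ?p t = 0}" by (simp add: poly_monom)
  ultimately show ?thesis using card_poly_roots_bound[of ?p] by simp
qed

text \<open>
  If \<open>k\<close> is no multiple of the group order, some \<open>g\<close> has \<open>g ^ k \<noteq> 1\<close>, because the polynomial
  \<open>t ^ r - 1\<close> with \<open>r\<close> the reduced exponent has too few roots. Substituting \<open>g x\<close> for \<open>x\<close> multiplies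
  the sum by \<open>g ^ k\<close>, so the sum is 0.
\<close>
lemma sum_nonzero_powers:
  "(\<Sum>x\<in>-{0::'a::finite_field}. x ^ k) = (if CARD('a) - 1 dvd k then -1 else 0)"
proof (cases "CARD('a) - 1 dvd k")
  case True
  have "(\<Sum>x\<in>-{0::'a}. x ^ k) = (\<Sum>x\<in>-{0::'a}. 1)"
    by (rule sum.cong) (use True in \<open>simp_all add: finite_field_power_eq_1\<close>)
  also have "\<dots> = of_nat (CARD('a) - 1)" by (simp add: card_nonzero)
  also have "\<dots> = (-1 :: 'a)"
    using CARD_finite_field_gt_1[where 'a = 'a] by (simp add: of_nat_diff finite_field_of_nat_CARD)
  finally show ?thesis using True by simp
next
  case False
  define r where "r = k mod (CARD('a) - 1)"
  have r: "0 < r" "r < CARD('a) - 1"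
    using False CARD_finite_field_gt_1[where 'a = 'a] by (auto simp: r_def dvd_eq_mod_eq_0)
  have "card {t::'a. t ^ r = 1} < card (-{0::'a})"
    using card_nth_roots_le[OF r(1), of "1 :: 'a"] r by (simp add: card_nonzero)
  then have "\<not> - {0} \<subseteq> {t::'a. t ^ r = 1}"
    using card_mono[of "{t::'a. t ^ r = 1}" "- {0}"] by auto
  then obtain g :: 'a where g: "g \<noteq> 0" "g ^ r \<noteq> 1" by auto
  have "g ^ k = g ^ ((CARD('a) - 1) * (k div (CARD('a) - 1)) + r)" by (simp add: r_def)
  also have "\<dots> = g ^ r"
    using finite_field_power_eq_1[OF g(1) dvd_triv_left] by (simp only: power_add mult_1_left)
  finally have gk: "g ^ k \<noteq> 1" using g by simp
  have "(\<Sum>x\<in>-{0::'a}. x ^ k) = (\<Sum>x\<in>-{0::'a}. (g * x) ^ k)"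
    by (rule sum.reindex_bij_witness[of _ "\<lambda>x. g * x" "\<lambda>x. x / g"]) (use g in auto)
  also have "\<dots> = g ^ k * (\<Sum>x\<in>-{0::'a}. x ^ k)" by (simp add: power_mult_distrib sum_distrib_left)
  finally have "(g ^ k - 1) * (\<Sum>x\<in>-{0::'a}. x ^ k) = 0" by (simp add: algebra_simps)
  then show ?thesis using gk False by simp
qed

text \<open>
  A counting substitute for cyclicity of the multiplicative group: the fibres of \<open>t \<mapsto> t ^ m\<close> have at
  most \<open>m\<close> elements, so its image has at least \<open>d\<close> elements and exhausts the \<open>d\<close>-th roots of unity.
\<close>
lemma ex_nth_root_if_root_of_unity:
  fixes X :: "'a::finite_field"
  assumes card: "CARD('a) - 1 = m * d" and X: "X ^ d = 1"
  shows "\<exists>t. t \<noteq> 0 \<and> t ^ m = X"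
proof -
  have pos: "m > 0" "d > 0"
    using card CARD_finite_field_gt_1[where 'a = 'a] by (auto intro: Nat.gr0I)
  let ?S = "(\<lambda>t::'a. t ^ m) ` (-{0})"
  have sub: "?S \<subseteq> {Y. Y ^ d = 1}"
    using finite_field_power_eq_1[where 'a = 'a and k = "m * d"] card by (auto simp flip: power_mult)
  have "m * d = card (-{0::'a})" by (simp add: card_nonzero flip: card)
  also have "\<dots> \<le> card (\<Union>Y\<in>?S. {t. t ^ m = Y})" by (rule card_mono) auto
  also have "\<dots> \<le> (\<Sum>Y\<in>?S. card {t. t ^ m = Y})" by (rule card_UN_le) simp
  also have "\<dots> \<le> (\<Sum>Y\<in>?S. m)" by (rule sum_mono) (rule card_nth_roots_le[OF pos(1)])
  also have "\<dots> = m * card ?S" by simp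
  finally have "d \<le> card ?S" using pos by simp
  then have "?S = {Y. Y ^ d = 1}"
    using card_nth_roots_le[OF pos(2), of "1 :: 'a"] sub by (intro card_seteq) auto
  then show ?thesis using X by (metis (mono_tags, lifting) ComplD imageE mem_Collect_eq singletonI)
qed

section \<open>Cubic extensions of finite fields with an even power of two elements\<close>

text \<open>
  For \<open>q = 2 ^ n\<close>, such an odd \<open>e\<close> exists exactly if \<open>n\<close> is even and positive. Expressing \<open>q\<close> and
  \<open>D\<close> through \<open>e\<close> turns every identity between exponents into a polynomial identity in \<open>e\<close>.
\<close>

locale char_2_cubic_field =
  fixes n q e D :: nat and field_type :: "'a::finite_field itself"
  assumes q_power: "q = 2 ^ n" and card_eq: "CARD('a) = q ^ 3"
    and q_eq: "q = 3 * e + 1" and odd_e: "odd e" and D_eq: "D = 3 * e\<^sup>2 + 3 * e + 1"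
begin

lemma three_D: "q\<^sup>2 + q + 1 = 3 * D"
  by (simp add: q_eq D_eq power2_eq_square algebra_simps)

lemma card_minus_1: "CARD('a) - 1 = 3 * (q - 1) * D"
  by (simp add: card_eq q_eq D_eq power2_eq_square power3_eq_cube algebra_simps)

lemma e_pos: "e > 0"
  using odd_e by (auto intro: Nat.gr0I)

lemma q_ge_4: "q \<ge> 4"
  using e_pos by (simp add: q_eq)

lemma q_pos: "q > 0"
  by (simp add: q_eq)

lemma D_pos: "D > 0"
  by (simp add: D_eq)

lemma two_D_le: "2 * D \<le> q\<^sup>2"
  using e_pos by (cases e) (simp_all add: D_eq q_eq power2_eq_square algebra_simps)

lemma D_mod_3: "D mod 3 = 1"
proof -
  have "D = 1 + 3 * (e\<^sup>2 + e)" by (simp add: D_eq)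
  then show ?thesis by simp
qed

lemma two_eq_0: "(2 :: 'a) = 0"
proof -
  have "(2 :: 'a) ^ (n * 3) = 0"
    using finite_field_of_nat_CARD[where 'a = 'a] by (simp add: card_eq q_power power_mult)
  then show ?thesis by simp
qed

lemma CHAR_eq_2: "CHAR('a) = 2"
  by (rule CHAR_eq_posI) (auto simp: two_eq_0 less_2_cases_iff)

lemma minus_eq_plus: "x - y = (x + y :: 'a)"
  by (rule minus_CHAR_2[OF CHAR_eq_2])

lemma add_self: "x + x = (0 :: 'a)"
  using two_eq_0 by (metis mult_2 mult_zero_left)

lemma eq_if_add_eq_0: "x + y = (0 :: 'a) \<Longrightarrow> x = y"
  by (metis minus_eq_plus right_minus_eq)

lemma add_power_2_power: "(x + y :: 'a) ^ (2 ^ k) = x ^ (2 ^ k) + y ^ (2 ^ k)"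
  by (rule freshmans_dream'[where n = k]) (simp_all add: CHAR_eq_2)

lemma add_power_q: "(x + y :: 'a) ^ q = x ^ q + y ^ q"
  by (simp add: q_power add_power_2_power)

lemma power2_eq_iff_char_2: "x\<^sup>2 = y\<^sup>2 \<longleftrightarrow> x = (y :: 'a)"
  (is "?l \<longleftrightarrow> ?r")
proof
  assume ?l
  then have "(x + y)\<^sup>2 = 0" using add_power_2_power[of x y 1] by (simp add: add_self)
  then show ?r by (simp add: eq_if_add_eq_0)
qed simp

lemma power_q_q_q: "(((x :: 'a) ^ q) ^ q) ^ q = x"
  using finite_field_power_card_eq_same[of x]
  by (simp add: card_eq power3_eq_cube mult.assoc flip: power_mult)

lemma primitive_cube_root_power:
  assumes "c\<^sup>2 + c + 1 = (0 :: 'a)" and "k mod 3 = 1"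
  shows "c ^ k = c"
proof -
  have "c ^ 3 - 1 = (c - 1) * (c\<^sup>2 + c + 1)"
    by (simp add: power2_eq_square power3_eq_cube algebra_simps)
  then have "c ^ 3 = 1" using assms by simp
  moreover have "k = 3 * (k div 3) + 1" using assms(2) by presburger
  ultimately show ?thesis by (metis mult_1_left power_add power_mult power_one power_one_right)
qed

section \<open>Injectivity\<close>

text \<open>
  A zero \<open>u\<close> also lies on the two conjugate lines; subtracting their equations pairwise shows that
  \<open>u\<close> equals its conjugates, and then \<open>k u = 0\<close>.
\<close>
lemma conjugate_line_anisotropic:
  assumes line: "k * u + u ^ q + (u ^ q) ^ q = (0 :: 'a)"
    and k: "k ^ q = k" "k \<noteq> 0" "k \<noteq> 1"
  shows "u = 0"
proof -
  define v w where "v = u ^ q" and "w = v ^ q"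
  have w: "w ^ q = u" by (simp add: w_def v_def power_q_q_q)
  have 1: "k * u + v + w = 0" using line by (simp add: v_def w_def)
  have v_q: "v ^ q = w" and u_q: "u ^ q = v" by (simp_all add: v_def w_def)
  have "(k * u + v + w) ^ q = k * v + w + u"
    unfolding add_power_q power_mult_distrib k(1) u_q v_q w ..
  then have 2: "k * v + w + u = 0" using 1 zero_power[OF q_pos] by metis
  have "(k * v + w + u) ^ q = k * w + u + v"
    unfolding add_power_q power_mult_distrib k(1) u_q v_q w ..
  then have 3: "k * w + u + v = 0" using 2 zero_power[OF q_pos] by metis
  have "(k - 1) * (u - v) = (k * u + v + w) - (k * v + w + u)" by (simp add: algebra_simps)
  then have "u = v" using 1 2 k by simp
  moreover have "(k - 1) * (v - w) = (k * v + w + u) - (k * w + u + v)" by (simp add: algebra_simps)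
  then have "v = w" using 2 3 k by simp
  ultimately show "u = 0" using 1 k by (simp add: add_self add.assoc)
qed

text \<open>
  With \<open>k = c\<^sup>2\<close>, the cubic form factors over the base field, up to a constant, into
  \<open>(k r + y + z) (r + k y + z) (r + y + k z)\<close>, where \<open>y\<close> and \<open>z\<close> are the conjugates of \<open>r\<close>.
\<close>
lemma cubic_form_anisotropic:
  assumes c: "c\<^sup>2 + c + 1 = (0 :: 'a)"
    and zero: "c * (r ^ 3 + (r ^ q) ^ 3 + ((r ^ q) ^ q) ^ 3) = r * r ^ q * (r ^ q) ^ q"
  shows "r = 0"
proof -
  define y z k where "y = r ^ q" and "z = y ^ q" and "k = c\<^sup>2"
  have z: "z ^ q = r" by (simp add: z_def y_def power_q_q_q)
  have cq: "c ^ q = c" by (rule primitive_cube_root_power[OF c]) (simp add: q_eq)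
  have kq: "k ^ q = k" using cq by (metis k_def power_commutes power_mult mult.commute)
  have k0: "k \<noteq> 0" using c by (auto simp: k_def)
  have k1: "k \<noteq> 1"
  proof
    assume "k = 1"
    then have "c = 0" using c by (simp add: k_def algebra_simps two_eq_0)
    then show False using c by simp
  qed
  have k: "k = c + 1"
    by (rule eq_if_add_eq_0) (use c in \<open>simp add: k_def add.assoc\<close>)
  have kk: "k\<^sup>2 + k + 1 = 0"
    using c by (simp add: k power2_eq_square algebra_simps add_self)
  have k3: "k ^ 3 + 3 * k + 2 = c"
  proof -
    have "k ^ 3 + 3 * k + 2 = (k - 1) * (k\<^sup>2 + k + 1) + 2 * (k + 1) + (k + 1)"
      by (simp add: power2_eq_square power3_eq_cube algebra_simps)
    also have "\<dots> = c" by (simp add: kk two_eq_0) (simp add: k add.assoc two_eq_0)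
    finally show ?thesis .
  qed
  have "(k * r + y + z) * (r + k * y + z) * (r + y + k * z)
      = k * (r ^ 3 + y ^ 3 + z ^ 3)
        + (k\<^sup>2 + k + 1) * (r\<^sup>2 * y + r\<^sup>2 * z + y\<^sup>2 * r + y\<^sup>2 * z + z\<^sup>2 * r + z\<^sup>2 * y)
        + (k ^ 3 + 3 * k + 2) * (r * y * z)"
    by (simp add: power2_eq_square power3_eq_cube algebra_simps)
  also have "\<dots> = c * (c * (r ^ 3 + y ^ 3 + z ^ 3)) + c * (r * y * z)"
    unfolding kk k3 by (simp add: k_def power2_eq_square mult.assoc)
  also have "\<dots> = 0" using zero by (simp add: y_def z_def add_self)
  finally have "k * r + y + z = 0 \<or> k * y + z + r = 0 \<or> k * z + r + y = 0"
    by (auto simp: add_ac)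
  then have "r = 0 \<or> y = 0 \<or> z = 0"
    using conjugate_line_anisotropic[of k r] conjugate_line_anisotropic[of k y]
      conjugate_line_anisotropic[of k z] kq k0 k1 z
    by (auto simp: y_def[symmetric] z_def[symmetric])
  then show "r = 0" by (auto simp: y_def z_def)
qed

text \<open>
  The two lemmas below identify the \<open>D\<close>-th roots of unity with the elements \<open>r\<^sup>2 / (r' r'')\<close>, where
  \<open>r' r'' / r\<^sup>2 = r ^ ((q - 1) (q + 2))\<close>. The exponent is \<open>3 (q - 1) (e + 1)\<close>: the power
  \<open>3 (q - 1)\<close> maps onto the roots of unity, and \<open>e + 1\<close> is invertible modulo \<open>D\<close> since
  \<open>(q - 1) (e + 1) = D - 1\<close>. This is why \<open>r = t ^ (q - 1)\<close> is the right choice.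
\<close>
lemma ex_square_over_conjugates:
  assumes "X ^ D = (1 :: 'a)"
  shows "\<exists>r. r \<noteq> 0 \<and> r\<^sup>2 = X * (r ^ q * (r ^ q) ^ q)"
proof -
  obtain t :: 'a where t: "t \<noteq> 0" "t ^ (3 * (q - 1)) = X"
    using ex_nth_root_if_root_of_unity[OF card_minus_1 assms] by blast
  define r where "r = t ^ (q - 1)"
  have exp: "(q - 1) * (q + q * q) = (q - 1) * 2 + 3 * (q - 1) * (D - 1)"
    by (simp add: q_eq D_eq power2_eq_square algebra_simps)
  have "r ^ q * (r ^ q) ^ q = t ^ ((q - 1) * (q + q * q))"
    by (simp add: r_def flip: power_mult power_add) (simp add: algebra_simps)
  also have "\<dots> = r\<^sup>2 * X ^ (D - 1)"
    unfolding exp by (simp only: r_def power_add power_mult flip: t(2))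
  finally have "X * (r ^ q * (r ^ q) ^ q) = r\<^sup>2 * X ^ Suc (D - 1)" by (simp add: mult_ac)
  also have "Suc (D - 1) = D" by (simp add: D_eq)
  finally show ?thesis using assms t(1) by (intro exI[of _ r]) (simp add: r_def)
qed

lemma power_D_square_over_conjugates:
  assumes "x \<noteq> (0 :: 'a)"
  shows "(x\<^sup>2 / (x ^ q * (x ^ q) ^ q)) ^ D = 1"
proof -
  have exp: "(q + q * q) * D = 2 * D + 3 * (q - 1) * D * (e + 1)"
    by (simp add: q_eq algebra_simps)
  have "x ^ (3 * (q - 1) * D * (e + 1)) = 1"
    by (rule finite_field_power_eq_1[OF assms]) (simp only: card_minus_1 dvd_triv_left)
  then have "(x ^ q * (x ^ q) ^ q) ^ D = (x\<^sup>2) ^ D"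
    using exp by (metis (no_types, lifting) mult.right_neutral power_add power_mult)
  then show ?thesis using assms by (simp add: power_divide)
qed

text \<open>
  In the proof, \<open>s\<close> is the point of collision in units of the difference \<open>\<delta>\<close>, so that the other
  point is \<open>s + 1\<close>.
\<close>
lemma quadratic_map_inj:
  assumes c: "(b ^ D)\<^sup>2 + b ^ D + 1 = (0 :: 'a)"
  shows "inj (\<lambda>x. x ^ (q\<^sup>2 + q) + b * x\<^sup>2)"
proof (rule injI, rule ccontr)
  fix x w :: 'a
  assume eq: "x ^ (q\<^sup>2 + q) + b * x\<^sup>2 = w ^ (q\<^sup>2 + q) + b * w\<^sup>2" and "x \<noteq> w"
  define \<delta> where "\<delta> = w - x"
  have \<delta>: "\<delta> \<noteq> 0" and w: "w = x + \<delta>" using \<open>x \<noteq> w\<close> by (auto simp: \<delta>_def)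
  define s where "s = x / \<delta>"
  define N where "N = \<delta> ^ q * (\<delta> ^ q) ^ q"
  have N0: "N \<noteq> 0" using \<delta> by (simp add: N_def)
  define T where "T = b * (\<delta>\<^sup>2 / N)"
  have x: "x = s * \<delta>" using \<delta> by (simp add: s_def)
  have pw: "u ^ (q\<^sup>2 + q) = u ^ q * (u ^ q) ^ q" for u :: 'a
    by (simp add: power_add power2_eq_square mult.commute flip: power_mult)
  have "s ^ q * (s ^ q) ^ q * N + b * (s\<^sup>2 * \<delta>\<^sup>2)
      = (s ^ q + 1) * ((s ^ q) ^ q + 1) * N + b * ((s\<^sup>2 + 1) * \<delta>\<^sup>2)"
  proof -
    have "w = (s + 1) * \<delta>" by (simp add: w x algebra_simps)
    moreover have "(s + 1)\<^sup>2 = s\<^sup>2 + 1" using add_power_2_power[of s 1 1] by simp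
    ultimately show ?thesis using eq
      by (simp add: x pw power_mult_distrib add_power_q N_def mult_ac)
  qed
  then have "(s ^ q + (s ^ q) ^ q + 1) * N + b * \<delta>\<^sup>2 = 0"
    by (simp add: algebra_simps)
  then have "((s ^ q + (s ^ q) ^ q + 1) * N + b * \<delta>\<^sup>2) / N = 0" by simp
  then have "s ^ q + (s ^ q) ^ q + 1 + T = 0"
    using N0 by (simp add: T_def add_divide_distrib)
  then have T: "T = s ^ q + (s ^ q) ^ q + 1" by (metis eq_if_add_eq_0)
  have Tq: "T ^ q = (s ^ q) ^ q + s + 1" by (simp add: T add_power_q power_q_q_q)
  have Tqq: "(T ^ q) ^ q = s + s ^ q + 1" by (simp add: Tq add_power_q power_q_q_q)
  \<comment> \<open>Each conjugate of \<open>s\<close> occurs twice in the trace of \<open>T\<close>.\<close>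
  have "T + T ^ q + (T ^ q) ^ q = 2 * (s + s ^ q + (s ^ q) ^ q + 1) + 1"
    unfolding Tqq unfolding Tq unfolding T by (simp add: algebra_simps)
  then have trace: "T + T ^ q + (T ^ q) ^ q = 1" by (simp add: two_eq_0)

  define c where "c = b ^ D"
  note c = c[folded c_def]
  have c0: "c \<noteq> 0" using c by auto
  have cD: "c ^ D = c" by (rule primitive_cube_root_power[OF c D_mod_3])
  have cq: "c ^ q = c" by (rule primitive_cube_root_power[OF c]) (simp add: q_eq)
  have "(\<delta>\<^sup>2 / N) ^ D = 1" unfolding N_def by (rule power_D_square_over_conjugates[OF \<delta>])
  then have "T ^ D = c" unfolding T_def power_mult_distrib c_def by simp
  then have "(T / c) ^ D = 1" using c0 by (simp add: power_divide cD)
  then obtain r where r: "r \<noteq> 0" "r\<^sup>2 = T / c * (r ^ q * (r ^ q) ^ q)"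
    using ex_square_over_conjugates by blast
  define y z where "y = r ^ q" and "z = y ^ q"
  have z: "z ^ q = r" by (simp add: z_def y_def power_q_q_q)
  have sq: "(u\<^sup>2) ^ q = (u ^ q)\<^sup>2" for u :: 'a by (simp add: mult.commute flip: power_mult)
  have 1: "c * r\<^sup>2 = T * (y * z)" using r c0 by (simp add: y_def z_def)
  have 2: "c * y\<^sup>2 = T ^ q * (z * r)"
    using arg_cong[OF 1, of "\<lambda>x. x ^ q"] z cq
    by (simp add: power_mult_distrib sq flip: y_def z_def)
  have 3: "c * z\<^sup>2 = (T ^ q) ^ q * (r * y)"
    using arg_cong[OF 2, of "\<lambda>x. x ^ q"] z cq
    by (simp add: power_mult_distrib sq flip: y_def z_def)
  have "c * (r ^ 3 + y ^ 3 + z ^ 3) = (c * r\<^sup>2) * r + (c * y\<^sup>2) * y + (c * z\<^sup>2) * z"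
    by (simp add: power2_eq_square power3_eq_cube algebra_simps)
  also have "\<dots> = (T + T ^ q + (T ^ q) ^ q) * (r * y * z)"
    unfolding 1 2 3 by (simp add: algebra_simps)
  finally have "r = 0"
    using cubic_form_anisotropic[OF c, of r] by (simp add: trace y_def z_def)
  with r show False by simp
qed

section \<open>Necessity by Hermite's criterion\<close>

text \<open>
  The binomial coefficients of \<open>2 ^ k - 1\<close> are all odd; equivalently, this is the factorization of
  \<open>u ^ 2 ^ k - v ^ 2 ^ k = (u - v) ^ 2 ^ k\<close>. The case \<open>u = v\<close> does not allow the cancellation.
\<close>
lemma add_power_2_power_minus_1:
  "(u + v :: 'a) ^ (2 ^ k - 1) = (\<Sum>i<2 ^ k. u ^ i * v ^ (2 ^ k - 1 - i))"
proof (cases "u = v")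
  case True
  have "(\<Sum>i<2 ^ k. u ^ i * v ^ (2 ^ k - 1 - i)) = (\<Sum>i<2 ^ k :: nat. u ^ (2 ^ k - 1))"
    by (rule sum.cong) (auto simp: True simp flip: power_add)
  then show ?thesis
    using one_less_power[of "2 :: nat" k]
    by (cases "k = 0") (simp_all add: True add_self two_eq_0 power_0_left)
next
  case False
  have "(u + v) * (u + v) ^ (2 ^ k - 1) = (u + v) ^ (2 ^ k)"
    by (simp flip: power_Suc)
  also have "\<dots> = u ^ (2 ^ k) - v ^ (2 ^ k)"
    by (simp add: add_power_2_power minus_eq_plus)
  also have "\<dots> = (u - v) * (\<Sum>i<2 ^ k. v ^ (2 ^ k - Suc i) * u ^ i)"
    by (rule power_diff_sumr2)
  also have "\<dots> = (u + v) * (\<Sum>i<2 ^ k. u ^ i * v ^ (2 ^ k - 1 - i))"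
    by (simp add: minus_eq_plus mult.commute)
  finally show ?thesis using False eq_if_add_eq_0 by auto
qed

text \<open>
  These are the \<open>i\<close> for which the binomial coefficient of \<open>q\<^sup>2 - q - 1\<close> over \<open>i\<close> is odd: the base-\<open>q\<close>
  digits of \<open>q\<^sup>2 - q - 1\<close> are \<open>q - 2\<close> and \<open>q - 1\<close>, so in binary it has the digit 1 in all of its
  \<open>2n\<close> places but one, the lowest place of the leading base-\<open>q\<close> digit.
\<close>
definition exponents :: "nat set" where
  "exponents = {i. i < q\<^sup>2 \<and> even (i div q)}"

lemma finite_exponents: "finite exponents"
  by (simp add: exponents_def)

lemma even_q: "even q"
  using odd_e by (simp add: q_eq)

lemma exponents_le:
  assumes "i \<in> exponents"
  shows "i \<le> q\<^sup>2 - q - 1"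
proof -
  have "i div q < q"
    using assms q_pos by (simp add: exponents_def power2_eq_square less_mult_imp_div_less)
  moreover have "i div q \<noteq> q - 1"
    using assms even_q q_pos by (auto simp: exponents_def)
  ultimately have "Suc (i div q) \<le> q - 1" by simp
  then have "i < (q - 1) * q"
    using q_pos by (meson div_less_iff_less_mult less_eq_Suc_le)
  then show ?thesis by (simp add: power2_eq_square algebra_simps)
qed

lemma div_q: "r < q \<Longrightarrow> (r + j * q) div q = j"
  by simp

text \<open>
  As \<open>q\<^sup>2 - q - 1 = (q - 1) + 2 q (q / 2 - 1)\<close>, two applications of \<open>add_power_2_power_minus_1\<close>
  expand the power, the second one to \<open>u ^ (2 q)\<close> and \<open>v ^ (2 q)\<close>.
\<close>
lemma add_power_exponents:
  "(u + v :: 'a) ^ (q\<^sup>2 - q - 1) = (\<Sum>i\<in>exponents. u ^ i * v ^ (q\<^sup>2 - q - 1 - i))"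
proof -
  define h where "h = q div 2"
  have q: "q = 2 * h" using even_q by (simp add: h_def)
  have n: "n > 0" using even_q q_power by (cases n) auto
  have h: "h = 2 ^ (n - 1)" using n q_power q by (cases n) auto
  have h0: "h > 0" by (simp add: h)
  have exp: "q\<^sup>2 - q - 1 = (q - 1) + 2 * q * (h - 1)"
    using h0 by (cases h) (simp_all add: q power2_eq_square algebra_simps)
  have Frobenius: "(u + v) ^ (2 * q) = u ^ (2 * q) + v ^ (2 * q)"
    using add_power_2_power[of u v "Suc n"] by (simp add: q_power)
  have "(u + v) ^ (q\<^sup>2 - q - 1)
      = (u + v) ^ (2 ^ n - 1) * (u ^ (2 * q) + v ^ (2 * q)) ^ (2 ^ (n - 1) - 1)"
    unfolding exp power_add power_mult[of _ "2 * q"] Frobenius by (simp only: h q_power)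
  also have "\<dots> = (\<Sum>m<q. u ^ m * v ^ (q - 1 - m))
      * (\<Sum>j<h. (u ^ (2 * q)) ^ j * (v ^ (2 * q)) ^ (h - 1 - j))"
    unfolding add_power_2_power_minus_1 by (simp only: h q_power)
  also have "\<dots> = (\<Sum>(m, j)\<in>{..<q} \<times> {..<h}.
      u ^ (m + 2 * q * j) * v ^ ((q - 1 - m) + 2 * q * (h - 1 - j)))"
    by (simp only: sum_product sum.cartesian_product power_add power_mult) (simp only: mult_ac)
  also have "\<dots> = (\<Sum>i\<in>exponents. u ^ i * v ^ (q\<^sup>2 - q - 1 - i))"
  proof (rule sum.reindex_bij_witness[of _ "\<lambda>i. (i mod q, i div q div 2)"
        "\<lambda>(m, j). m + 2 * q * j"])
    fix a assume "a \<in> {..<q} \<times> {..<h}"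
    then obtain m j where a: "a = (m, j)" and m: "m < q" and j: "j < h" by auto
    have digits: "m + 2 * q * j = m + (2 * j) * q" by simp
    have div: "(m + 2 * q * j) div q = 2 * j" unfolding digits using m by (rule div_q)
    have "(m + 2 * q * j) mod q = m" unfolding digits using m by (simp only: mod_mult_self1 mod_less)
    then show "((case a of (m, j) \<Rightarrow> m + 2 * q * j) mod q,
        (case a of (m, j) \<Rightarrow> m + 2 * q * j) div q div 2) = a"
      unfolding a prod.case div by simp
    have "m + 2 * q * j < q * (2 * j + 1)" using m by (simp add: algebra_simps)
    also have "\<dots> \<le> q * q" using j by (intro mult_left_mono) (auto simp: q)
    finally show "(case a of (m, j) \<Rightarrow> m + 2 * q * j) \<in> exponents"
      using div by (simp add: a exponents_def power2_eq_square)
    have "q * (h - 1) = q * j + q * (h - 1 - j)"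
      using j by (simp flip: distrib_left)
    then have "(q - 1 - m) + 2 * q * (h - 1 - j) = q\<^sup>2 - q - 1 - (m + 2 * q * j)"
      using m unfolding exp by simp
    then show "u ^ (case a of (m, j) \<Rightarrow> m + 2 * q * j)
          * v ^ (q\<^sup>2 - q - 1 - (case a of (m, j) \<Rightarrow> m + 2 * q * j))
        = (case a of (m, j) \<Rightarrow> u ^ (m + 2 * q * j) * v ^ ((q - 1 - m) + 2 * q * (h - 1 - j)))"
      unfolding a prod.case by simp
  next
    fix i assume "i \<in> exponents"
    then have i: "i < q * q" "even (i div q)" by (auto simp: exponents_def power2_eq_square)
    have "2 * q * (i div q div 2) = q * (i div q)"
      using i(2) by (simp add: mult.assoc mult.left_commute)
    then show "(case (i mod q, i div q div 2) of (m, j) \<Rightarrow> m + 2 * q * j) = i"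
      by (simp only: prod.case mod_mult_div_eq)
    have "i div q < q" using i(1) by (simp add: less_mult_imp_div_less)
    then show "(i mod q, i div q div 2) \<in> {..<q} \<times> {..<h}"
      using q_pos by (simp add: q less_mult_imp_div_less)
  qed
  finally show ?thesis .
qed

text \<open>
  The exponent is \<open>3 (q - 1) (e + 1) p\<close>, where \<open>e + 1\<close> is invertible modulo \<open>D\<close> and \<open>3 (q - 1) D\<close>
  is the order of the multiplicative group. The value 1 is the \<open>-1\<close> of \<open>sum_nonzero_powers\<close>.
\<close>
lemma sum_powers_root_of_unity:
  "(\<Sum>x\<in>-{0::'a}. (x ^ ((q - 1) * (q + 2))) ^ p) = (if D dvd p then 1 else 0)"
proof -
  have "D dvd (e + 1) * p \<longleftrightarrow> D dvd p"
  proof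
    assume "D dvd (e + 1) * p"
    \<comment> \<open>\<open>3 e (e + 1) = D - 1\<close>, so \<open>3 e\<close> inverts \<open>e + 1\<close> up to sign.\<close>
    then have "D dvd 3 * e * ((e + 1) * p)" by (rule dvd_mult)
    moreover have "D * p = 3 * e * ((e + 1) * p) + p"
      by (simp add: D_eq power2_eq_square algebra_simps)
    ultimately show "D dvd p" by (metis dvd_add_right_iff dvd_triv_left)
  qed simp
  moreover have "(q - 1) * (q + 2) * p = 3 * (q - 1) * ((e + 1) * p)"
    by (simp add: q_eq algebra_simps)
  moreover have "3 * (q - 1) > 0" using q_ge_4 by simp
  ultimately have "CARD('a) - 1 dvd (q - 1) * (q + 2) * p \<longleftrightarrow> D dvd p"
    by (simp only: card_minus_1 nat_mult_dvd_cancel1)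
  then show ?thesis
    by (simp add: sum_nonzero_powers uminus_CHAR_2[OF CHAR_eq_2] flip: power_mult)
qed

lemma D_dvd_iff:
  assumes "0 < j" and "j \<le> q\<^sup>2"
  shows "D dvd j \<longleftrightarrow> j = D \<or> j = 2 * D"
proof
  assume "D dvd j"
  then obtain l where l: "j = D * l" by blast
  have "j < D * 3" using assms three_D by simp
  then have "l < 3" "l \<noteq> 0" using assms l by auto
  then show "j = D \<or> j = 2 * D" using l by (auto simp: numeral_3_eq_3 less_Suc_eq)
qed auto

text \<open>\<open>D\<close> and \<open>2 D\<close> are no exponents because their leading base-\<open>q\<close> digits \<open>e\<close> and \<open>2 e + 1\<close> are odd.\<close>
lemma exponents_dvd_iff:
  assumes "i \<in> exponents"
  shows "D dvd 3 * D - i \<longleftrightarrow> i = 0"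
proof -
  have i: "i < q\<^sup>2" "even (i div q)" using assms by (auto simp: exponents_def)
  have "D = (2 * e + 1) + e * q" by (simp add: D_eq q_eq power2_eq_square algebra_simps)
  then have "D div q = e" using div_q[of "2 * e + 1" e] e_pos q_eq by simp
  then have 1: "i \<noteq> D" using i odd_e by auto
  have "2 * D = (e + 1) + (2 * e + 1) * q" by (simp add: D_eq q_eq power2_eq_square algebra_simps)
  then have "2 * D div q = 2 * e + 1" using div_q[of "e + 1" "2 * e + 1"] e_pos q_eq by simp
  then have 2: "i \<noteq> 2 * D" using i by auto
  have "3 * D = (3 * D - i) + i" using i three_D by simp
  then have *: "D dvd 3 * D - i \<longleftrightarrow> D dvd i"
    by (metis dvd_add_left_iff dvd_add_right_iff dvd_triv_right)
  show ?thesis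
  proof (cases "i = 0")
    case False
    then have "D dvd i \<longleftrightarrow> i = D \<or> i = 2 * D" using i by (intro D_dvd_iff) auto
    with * False 1 2 show ?thesis by blast
  qed simp
qed

lemma exponents_dvd_add_q2_iff:
  assumes "i \<in> exponents"
  shows "D dvd q\<^sup>2 + 3 * D - i \<longleftrightarrow> i = q\<^sup>2 - D \<or> i = q\<^sup>2 - 2 * D"
proof -
  have i: "i < q\<^sup>2" using assms by (simp add: exponents_def)
  have "q\<^sup>2 + 3 * D - i = (q\<^sup>2 - i) + 3 * D" using i by simp
  then have "D dvd q\<^sup>2 + 3 * D - i \<longleftrightarrow> D dvd q\<^sup>2 - i" by (simp only: dvd_add_times_triv_right_iff)
  also have "\<dots> \<longleftrightarrow> q\<^sup>2 - i = D \<or> q\<^sup>2 - i = 2 * D" using i by (intro D_dvd_iff) auto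
  also have "\<dots> \<longleftrightarrow> i = q\<^sup>2 - D \<or> i = q\<^sup>2 - 2 * D" using i two_D_le by auto
  finally show ?thesis .
qed

text \<open>
  In contrast to \<open>D\<close> and \<open>2 D\<close>, their complements \<open>q\<^sup>2 - D\<close> and \<open>q\<^sup>2 - 2 D\<close> have the even leading
  base-\<open>q\<close> digits \<open>2 e\<close> and \<open>e - 1\<close>.
\<close>
lemma surviving_exponents:
  shows "0 \<in> exponents" and "q\<^sup>2 - D \<in> exponents" and "q\<^sup>2 - 2 * D \<in> exponents"
proof -
  show "0 \<in> exponents" using q_pos by (simp add: exponents_def)
  have "q\<^sup>2 - D = e + (2 * e) * q"
    by (simp add: D_eq q_eq power2_eq_square algebra_simps)
  then have "(q\<^sup>2 - D) div q = 2 * e" using div_q[of e "2 * e"] q_eq by simp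
  then show "q\<^sup>2 - D \<in> exponents" using D_pos two_D_le by (simp add: exponents_def)
  have "q\<^sup>2 - 2 * D = 2 * e + (e - 1) * q"
    using e_pos by (cases e) (simp_all add: D_eq q_eq power2_eq_square algebra_simps)
  then have "(q\<^sup>2 - 2 * D) div q = e - 1" using div_q[of "2 * e" "e - 1"] q_eq by simp
  then show "q\<^sup>2 - 2 * D \<in> exponents" using D_pos two_D_le odd_e by (simp add: exponents_def)
qed

text \<open>
  The exponent \<open>k = (q - 1) (2 q + 1)\<close> equals \<open>(q\<^sup>2 - q - 1) + q\<^sup>2\<close>. Being a multiple of \<open>q - 1\<close>, it
  makes \<open>g x ^ k\<close> depend on \<open>X x\<close> only; its second summand is a Frobenius power and costs just one
  extra term, so that the expansion of \<open>(b + X x) ^ k\<close> stays sparse.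
\<close>
lemma quadratic_map_inj_imp:
  assumes inj: "inj (\<lambda>x::'a. x ^ (q\<^sup>2 + q) + b * x\<^sup>2)" and b: "b \<noteq> 0"
  shows "(b ^ D)\<^sup>2 + b ^ D + 1 = 0"
proof -
  define g where "g = (\<lambda>x::'a. x ^ (q\<^sup>2 + q) + b * x\<^sup>2)"
  define X where "X = (\<lambda>x::'a. x ^ ((q - 1) * (q + 2)))"
  define k where "k = (q - 1) * (2 * q + 1)"
  have inj_g: "inj_on g A" for A using inj inj_on_subset unfolding g_def by blast
  have "g 0 = 0" using q_pos by (simp add: g_def)
  then have "g ` (-{0}) \<subseteq> -{0}" using injD[OF inj_g, of _ 0] by auto
  then have im: "g ` (-{0}) = -{0}" by (intro endo_inj_surj inj_g) auto
  have "(\<Sum>x\<in>-{0}. g x ^ k) = (\<Sum>y\<in>g ` (-{0}). y ^ k)"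
    by (simp add: sum.reindex[OF inj_g])
  also have "\<dots> = 0"
  proof -
    have "CARD('a) - 1 = (q - 1) * (3 * D)" by (simp only: card_minus_1 mult_ac)
    moreover have "\<not> 3 * D dvd 2 * q + 1"
    proof
      assume "3 * D dvd 2 * q + 1"
      then have "q\<^sup>2 + q + 1 \<le> 2 * q + 1" unfolding three_D by (rule dvd_imp_le) simp
      moreover have "4 * q \<le> q\<^sup>2" using q_ge_4 by (simp add: power2_eq_square)
      ultimately show False using q_ge_4 by simp
    qed
    moreover have "q - 1 > 0" using q_ge_4 by simp
    ultimately have "\<not> CARD('a) - 1 dvd k"
      unfolding k_def by (simp only: nat_mult_dvd_cancel1) simp
    then show ?thesis unfolding im sum_nonzero_powers by simp
  qed
  finally have sum_0: "(\<Sum>x\<in>-{0}. g x ^ k) = 0" .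

  have expand: "g x ^ k = (\<Sum>i\<in>exponents. b ^ (q\<^sup>2 + i) * X x ^ (3 * D - i)
      + b ^ i * X x ^ (q\<^sup>2 + 3 * D - i))" if "x \<noteq> 0" for x
  proof -
    have exp: "q\<^sup>2 + q = 2 + (q - 1) * (q + 2)"
      using q_ge_4 by (simp add: q_eq power2_eq_square algebra_simps)
    have "g x = x\<^sup>2 * (b + X x)"
      unfolding g_def X_def exp power_add by (simp only: distrib_left mult_ac add_ac)
    then have "g x ^ k = x ^ (2 * k) * (b + X x) ^ k"
      by (simp add: power_mult_distrib power_mult)
    also have "x ^ (2 * k) = X x ^ (2 * q + 2)"
    proof -
      \<comment> \<open>The two exponents of \<open>x\<close> agree modulo the order \<open>3 (q - 1) D\<close> of the multiplicative group.\<close>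
      have exp: "(q - 1) * (q + 2) * (2 * q + 2) = 2 * k + 3 * (q - 1) * D * 2"
        by (simp add: k_def q_eq D_eq power2_eq_square algebra_simps)
      have "x ^ (3 * (q - 1) * D * 2) = 1"
        by (rule finite_field_power_eq_1[OF that]) (simp only: card_minus_1 dvd_triv_left)
      then show ?thesis unfolding X_def power_mult[symmetric] exp by (simp only: power_add mult_1_right)
    qed
    also have "(b + X x) ^ k = (b + X x) ^ (q\<^sup>2 - q - 1) * (b + X x) ^ (q\<^sup>2)"
    proof -
      have "k = (q\<^sup>2 - q - 1) + q\<^sup>2"
        using e_pos by (cases e) (simp_all add: k_def q_eq power2_eq_square algebra_simps)
      then show ?thesis by (simp only: power_add)
    qed
    also have "(b + X x) ^ (q\<^sup>2) = b ^ (q\<^sup>2) + X x ^ (q\<^sup>2)"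
      by (simp add: power2_eq_square power_mult add_power_q)
    also have "(b + X x) ^ (q\<^sup>2 - q - 1) = (\<Sum>i\<in>exponents. b ^ i * X x ^ (q\<^sup>2 - q - 1 - i))"
      by (rule add_power_exponents)
    also have "X x ^ (2 * q + 2)
          * ((\<Sum>i\<in>exponents. b ^ i * X x ^ (q\<^sup>2 - q - 1 - i)) * (b ^ q\<^sup>2 + X x ^ q\<^sup>2))
      = (\<Sum>i\<in>exponents. X x ^ (2 * q + 2)
          * (b ^ i * X x ^ (q\<^sup>2 - q - 1 - i) * (b ^ q\<^sup>2 + X x ^ q\<^sup>2)))"
      by (simp only: sum_distrib_left sum_distrib_right)
    also have "\<dots> = (\<Sum>i\<in>exponents. b ^ (q\<^sup>2 + i) * X x ^ (3 * D - i)
      + b ^ i * X x ^ (q\<^sup>2 + 3 * D - i))"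
    proof (rule sum.cong[OF refl])
      fix i assume "i \<in> exponents"
      note i = exponents_le[OF this]
      have "4 * q \<le> q\<^sup>2" using q_ge_4 by (simp add: power2_eq_square)
      then have "q + 1 \<le> q\<^sup>2" using q_ge_4 by linarith
      then have 1: "3 * D - i = (2 * q + 2) + (q\<^sup>2 - q - 1 - i)"
        and 2: "q\<^sup>2 + 3 * D - i = (2 * q + 2) + (q\<^sup>2 - q - 1 - i) + q\<^sup>2"
        using i three_D by arith+
      show "X x ^ (2 * q + 2) * (b ^ i * X x ^ (q\<^sup>2 - q - 1 - i) * (b ^ q\<^sup>2 + X x ^ q\<^sup>2))
        = b ^ (q\<^sup>2 + i) * X x ^ (3 * D - i) + b ^ i * X x ^ (q\<^sup>2 + 3 * D - i)"
        unfolding 1 2 power_add by (simp only: distrib_left mult_ac)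
    qed
    finally show ?thesis .
  qed
  have "(\<Sum>x\<in>-{0}. g x ^ k) = (\<Sum>x\<in>-{0}. \<Sum>i\<in>exponents.
      b ^ (q\<^sup>2 + i) * X x ^ (3 * D - i) + b ^ i * X x ^ (q\<^sup>2 + 3 * D - i))"
    by (rule sum.cong[OF refl]) (simp only: expand Compl_iff singleton_iff not_False_eq_True)
  also have "\<dots> = (\<Sum>i\<in>exponents. b ^ (q\<^sup>2 + i) * (\<Sum>x\<in>-{0}. X x ^ (3 * D - i))
      + b ^ i * (\<Sum>x\<in>-{0}. X x ^ (q\<^sup>2 + 3 * D - i)))"
    by (subst sum.swap) (simp add: sum.distrib sum_distrib_left)
  also have "\<dots> = (\<Sum>i\<in>exponents. (if i = 0 then b ^ q\<^sup>2 else 0)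
      + (if i = q\<^sup>2 - D then b ^ (q\<^sup>2 - D) else 0)
      + (if i = q\<^sup>2 - 2 * D then b ^ (q\<^sup>2 - 2 * D) else 0))"
  proof (rule sum.cong[OF refl])
    fix i assume i: "i \<in> exponents"
    have "q\<^sup>2 - D \<noteq> q\<^sup>2 - 2 * D" using D_pos two_D_le by linarith
    then show "b ^ (q\<^sup>2 + i) * (\<Sum>x\<in>-{0}. X x ^ (3 * D - i))
        + b ^ i * (\<Sum>x\<in>-{0}. X x ^ (q\<^sup>2 + 3 * D - i))
      = (if i = 0 then b ^ q\<^sup>2 else 0) + (if i = q\<^sup>2 - D then b ^ (q\<^sup>2 - D) else 0)
      + (if i = q\<^sup>2 - 2 * D then b ^ (q\<^sup>2 - 2 * D) else 0)"
      unfolding X_def sum_powers_root_of_unity exponents_dvd_iff[OF i] exponents_dvd_add_q2_iff[OF i]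
      by (cases "i = 0"; cases "i = q\<^sup>2 - D"; cases "i = q\<^sup>2 - 2 * D") simp_all
  qed
  also have "\<dots> = b ^ q\<^sup>2 + b ^ (q\<^sup>2 - D) + b ^ (q\<^sup>2 - 2 * D)"
    by (simp add: sum.distrib finite_exponents surviving_exponents)
  also have "\<dots> = b ^ (q\<^sup>2 - 2 * D) * ((b ^ D)\<^sup>2 + b ^ D + 1)"
  proof -
    obtain j where j: "q\<^sup>2 = 2 * D + j" using two_D_le by (metis le_iff_add)
    have "q\<^sup>2 - D = D + j" and "q\<^sup>2 - 2 * D = j" and "q\<^sup>2 = D + (D + j)" using j by simp_all
    then show ?thesis by (simp only: power_add power2_eq_square distrib_left mult_1_left mult_1_right mult_ac)
  qed
  finally show ?thesis using b unfolding sum_0 by simp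
qed

end

section \<open>The permutation criterion\<close>

theorem theorem8:
  fixes n q :: nat and a :: "'a::finite_field"
  assumes "n > 0" and "even n"
    and "q = 2 ^ n"
    and "CARD('a) = q ^ 3"
    and "a \<noteq> 0"
  shows "permutation_polynomial (Polynomial.monom 1 ((q\<^sup>2 + q) div 2) + Polynomial.monom a 1)
     \<longleftrightarrow> a \<in> \<mu> (q\<^sup>2 + q + 1) \<and> a \<notin> \<mu> ((q\<^sup>2 + q + 1) div 3)"
proof -
  obtain m where m: "n = 2 * m" "m > 0" using assms(1,2) by (auto elim: evenE)
  have "(2 :: nat) ^ n mod 3 = (2 ^ 2 mod 3) ^ m mod 3" by (simp only: m power_mult power_mod)
  then have "q mod 3 = 1" by (simp add: assms(3))
  then obtain e where e: "q = 3 * e + 1" by (metis mult_div_mod_eq)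
  have "even q" using assms(1,3) by simp
  then have "odd e" using e by simp
  define D where "D = 3 * e\<^sup>2 + 3 * e + 1"
  interpret char_2_cubic_field n q e D "TYPE('a)"
    by unfold_locales (use assms e \<open>odd e\<close> in \<open>auto simp: D_def\<close>)
  let ?f = "Polynomial.monom 1 ((q\<^sup>2 + q) div 2) + Polynomial.monom a 1"
  have "(poly ?f x)\<^sup>2 = x ^ (q\<^sup>2 + q) + a\<^sup>2 * x\<^sup>2" for x
  proof -
    have "(q\<^sup>2 + q) div 2 * 2 = q\<^sup>2 + q" by simp
    then show ?thesis
      using add_power_2_power[of "x ^ ((q\<^sup>2 + q) div 2)" "a * x" 1]
      by (simp add: poly_monom power_mult_distrib flip: power_mult)
  qed
  then have "inj (poly ?f) \<longleftrightarrow> inj (\<lambda>x. x ^ (q\<^sup>2 + q) + a\<^sup>2 * x\<^sup>2)"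
    unfolding inj_def by (metis power2_eq_iff_char_2)
  also have "\<dots> \<longleftrightarrow> ((a\<^sup>2) ^ D)\<^sup>2 + (a\<^sup>2) ^ D + 1 = 0"
    using quadratic_map_inj[of "a\<^sup>2"] quadratic_map_inj_imp[of "a\<^sup>2"] assms(5) by auto
  also have "((a\<^sup>2) ^ D)\<^sup>2 + (a\<^sup>2) ^ D + 1 = ((a ^ D)\<^sup>2 + a ^ D + 1)\<^sup>2"
    using add_power_2_power[of "(a ^ D)\<^sup>2" "a ^ D" 1] add_power_2_power[of "(a ^ D)\<^sup>2 + a ^ D" 1 1]
    by (simp add: mult.commute flip: power_mult)
  also have "\<dots> = 0 \<longleftrightarrow> (a ^ D)\<^sup>2 + a ^ D + 1 = 0" by simp
  also have "\<dots> \<longleftrightarrow> (a ^ D) ^ 3 = 1 \<and> a ^ D \<noteq> 1"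
  proof -
    have "(a ^ D) ^ 3 - 1 = (a ^ D - 1) * ((a ^ D)\<^sup>2 + a ^ D + 1)"
      by (simp add: power2_eq_square power3_eq_cube algebra_simps)
    then show ?thesis by (auto simp: two_eq_0)
  qed
  finally have "inj (poly ?f) \<longleftrightarrow> (a ^ D) ^ 3 = 1 \<and> a ^ D \<noteq> 1" .
  moreover have "bij (poly ?f) \<longleftrightarrow> inj (poly ?f)"
    unfolding bij_def by (metis finite finite_UNIV_inj_surj)
  moreover have "(q\<^sup>2 + q + 1) div 3 = D" by (simp only: three_D)
  ultimately show ?thesis
    unfolding permutation_polynomial_def roots_of_unity_def three_D
    by (simp add: mult.commute flip: power_mult)
qed

end
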